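(* Let $G$ be a 2-connected graph with $n \geq 3$ vertices. Then for every vertex $u \in V(G)$, $$\Omega_G(u) \leq \frac{n^2-1}{6}.$$ Moreover, this bound is achieved (for a vertex $u$) if and only if $G = C_n$, the cycle on $n$ vertices.
   Context: All graphs are finite, simple and undirected. For a connected graph $G$ and vertices $i,j$, the resistance distance $\Omega_G(i,j)$ is the effective resistance between $i$ and $j$ in the electrical network obtained from $G$ by replacing each edge with a unit resistor. For $u\in V(G)$, the resistive eccentricity index is $\Omega_G(u)=\sum_{v\in V(G)}\Omega_G(u,v)$. A graph is 2-connected if it is connected, has at least three vertices, and has no cut vertex. *)

theory Defs
  imports Complex_Main "Graph_Theory.Graph_Theory"
begin

text \<open>
  Finite simple undirected graphs are the symmetric digraphs of the locale \<^locale>\<open>graph\<close>: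
  an undirected edge is a pair of opposite arcs.
\<close>

text \<open>A vertex that separates two other vertices of the same component.\<close>

definition cut_vertex :: "('a, 'b) pre_digraph \<Rightarrow> 'a \<Rightarrow> bool" where
  "cut_vertex G v \<longleftrightarrow> v \<in> verts G \<and>
     (\<exists>x \<in> verts G - {v}. \<exists>y \<in> verts G - {v}.
        x \<rightarrow>\<^sup>*\<^bsub>G\<^esub> y \<and> \<not> x \<rightarrow>\<^sup>*\<^bsub>pre_digraph.del_vert G v\<^esub> y)"

definition two_connected :: "('a, 'b) pre_digraph \<Rightarrow> bool" where
  "two_connected G \<longleftrightarrow>
     Digraph_Component.connected G \<and> 3 \<le> card (verts G) \<and> (\<nexists>v. cut_vertex G v)"

text \<open>
  Electrical potentials when a unit current enters the network at \<open>i\<close> and leaves it at \<open>j\<close>,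
  every edge being a unit resistor. By Ohm's law the current along an edge from \<open>v\<close> to \<open>w\<close> is
  \<open>\<phi> v - \<phi> w\<close>; the equation is Kirchhoff's current law at \<open>v\<close>. For \<open>i = j\<close> no net current is
  injected.
\<close>

definition unit_current_potential ::
    "('a, 'b) pre_digraph \<Rightarrow> 'a \<Rightarrow> 'a \<Rightarrow> ('a \<Rightarrow> real) \<Rightarrow> bool" where
  "unit_current_potential G i j \<phi> \<longleftrightarrow>
     (\<forall>v \<in> verts G. (\<Sum>w \<in> {w \<in> verts G. v \<rightarrow>\<^bsub>G\<^esub> w}. \<phi> v - \<phi> w) =
        (if v = i then 1 else 0) - (if v = j then 1 else 0))"

text \<open>
  The effective resistance is the voltage between \<open>i\<close> and \<open>j\<close> under a unit current. In a connected
  graph such a potential exists and is unique on the vertices up to an additive constant, so the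
  description is proper for all vertices \<open>i\<close> and \<open>j\<close>.
\<close>

definition resistance_distance :: "('a, 'b) pre_digraph \<Rightarrow> 'a \<Rightarrow> 'a \<Rightarrow> real" where
  "resistance_distance G i j = (THE r. \<exists>\<phi>. unit_current_potential G i j \<phi> \<and> r = \<phi> i - \<phi> j)"

definition resistive_eccentricity :: "('a, 'b) pre_digraph \<Rightarrow> 'a \<Rightarrow> real" where
  "resistive_eccentricity G u = (\<Sum>v \<in> verts G. resistance_distance G u v)"

text \<open>The cycle on \<open>n\<close> vertices; only meaningful as a simple graph for \<open>n \<ge> 3\<close>.\<close>

definition cycle_graph :: "nat \<Rightarrow> nat pair_pre_digraph" where
  "cycle_graph n = \<lparr> pverts = {0..<n},
     parcs = {(i, j). i < n \<and> j < n \<and> (j = Suc i mod n \<or> i = Suc j mod n)} \<rparr>"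

end

theory Submission
  imports Defs "Jordan_Normal_Form.Determinant"
begin

text \<open>
  If \<open>u\<close> and \<open>v\<close> are at distance \<open>j\<close> along a cycle of length \<open>m\<close> in the graph, then
  \<open>\<Omega>(u, v) \<le> j (m - j) / m\<close>; summing over a cycle through \<open>u\<close> gives \<open>(m\<^sup>2 - 1) / 6\<close>. Starting
  from such a cycle, the graph is exhausted by attaching ears. Any two vertices of the part \<open>W\<close>
  built so far are joined by a path in \<open>W\<close> through \<open>u\<close>, so every ear with \<open>k\<close> new vertices lies on
  a cycle through \<open>u\<close> with at most \<open>|W|\<close> old vertices. The bounds from this cycle sum over the new
  vertices to less than \<open>((|W| + k)\<^sup>2 - |W|\<^sup>2) / 6\<close>. Equality therefore forces a Hamiltonian cycle,
  and a chord would put one of its ends on a shorter cycle through \<open>u\<close> with a strictly smaller bound.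
\<close>

section \<open>Potentials\<close>

text \<open>A trivial kernel gives a nonzero determinant and hence an inverse matrix; an enumeration
  of \<open>V\<close> carries the system over to matrices and back.\<close>

lemma injective_square_system_solvable:
  fixes A :: "'v \<Rightarrow> 'v \<Rightarrow> 'k::field"
  assumes fin: "finite V"
    and ker: "\<And>x. \<forall>v\<in>V. (\<Sum>w\<in>V. A v w * x w) = 0 \<Longrightarrow> \<forall>v\<in>V. x v = 0"
  shows "\<exists>x. \<forall>v\<in>V. (\<Sum>w\<in>V. A v w * x w) = b v"
proof -
  define n where "n = card V"
  obtain f where f: "bij_betw f {0..<n} V"
    using ex_bij_betw_nat_finite[OF fin] by (auto simp: n_def)
  define g where "g = the_inv_into {0..<n} f"
  have gf: "g (f i) = i" if "i < n" for i
    using f that by (auto simp: g_def bij_betw_def the_inv_into_f_f)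
  have fV: "f i \<in> V" if "i < n" for i
    using f that by (auto simp: bij_betw_def)
  have reindex: "(\<Sum>w\<in>V. h w) = (\<Sum>i = 0..<n. h (f i))" for h :: "'v \<Rightarrow> 'k"
    by (rule sum.reindex_bij_betw[OF f, symmetric])
  define M where "M = mat n n (\<lambda>(i, j). A (f i) (f j))"
  have M: "M \<in> carrier_mat n n"
    by (simp add: M_def)
  have Mx: "(M *\<^sub>v x) $ i = (\<Sum>w\<in>V. A (f i) w * x $ (g w))" if "x \<in> carrier_vec n" "i < n" for x i
    using that by (simp add: M_def scalar_prod_def reindex gf)
  have "det M \<noteq> 0"
  proof
    assume "det M = 0"
    then obtain x where x: "x \<in> carrier_vec n" "x \<noteq> 0\<^sub>v n" "M *\<^sub>v x = 0\<^sub>v n"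
      using det_0_iff_vec_prod_zero_field[OF M] by auto
    have "(\<Sum>w\<in>V. A v w * x $ (g w)) = 0" if "v \<in> V" for v
    proof -
      obtain i where i: "i < n" "v = f i"
        using f \<open>v \<in> V\<close> by (auto simp: bij_betw_def)
      show ?thesis
        using Mx[OF x(1) i(1)] i x(3) by simp
    qed
    then have "\<forall>v\<in>V. x $ (g v) = 0"
      using ker[of "\<lambda>v. x $ (g v)"] by simp
    then have "x $ i = 0" if "i < n" for i
      using fV[OF that] gf[OF that] by auto
    then have "x = 0\<^sub>v n"
      using x(1) by auto
    with x(2) show False by simp
  qed
  \<comment> \<open>The \<open>()\<close> is the value of the record extension in
    \<open>ring_mat\<close>.\<close>
  from det_non_zero_imp_unit[OF M this, of "()"]
  obtain N where N: "M * N = 1\<^sub>m n" "N \<in> carrier_mat n n"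
    unfolding Units_def ring_mat_def by auto
  define c where "c = vec n (b \<circ> f)"
  have c: "c \<in> carrier_vec n" by (simp add: c_def)
  have "M *\<^sub>v (N *\<^sub>v c) = c"
    using assoc_mult_mat_vec[OF M N(2) c] N(1) c by simp
  moreover have "N *\<^sub>v c \<in> carrier_vec n"
    using N(2) c by simp
  ultimately have "\<forall>v\<in>V. (\<Sum>w\<in>V. A v w * (N *\<^sub>v c) $ (g w)) = b v"
    using f Mx by (fastforce simp: bij_betw_def c_def)
  then show ?thesis
    by (intro exI[of _ "\<lambda>w. (N *\<^sub>v c) $ (g w)"])
qed

section \<open>Laplacian and Dirichlet energy\<close>

definition laplacian :: "('a, 'b) pre_digraph \<Rightarrow> ('a \<Rightarrow> real) \<Rightarrow> 'a \<Rightarrow> real" where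
  "laplacian G \<phi> v = (\<Sum>w \<in> {w \<in> verts G. v \<rightarrow>\<^bsub>G\<^esub> w}. \<phi> v - \<phi> w)"

text \<open>Every edge contributes two opposite arcs to \<open>arcs_ends G\<close>, hence the
  division by 2.\<close>

definition energy :: "('a, 'b) pre_digraph \<Rightarrow> ('a \<Rightarrow> real) \<Rightarrow> real" where
  "energy G \<phi> = (\<Sum>(v, w) \<in> arcs_ends G. (\<phi> v - \<phi> w)\<^sup>2) / 2"

lemma unit_current_potential_laplacian:
  "unit_current_potential G i j \<phi> \<longleftrightarrow>
    (\<forall>v \<in> verts G. laplacian G \<phi> v = of_bool (v = i) - of_bool (v = j))"
  by (simp add: unit_current_potential_def laplacian_def of_bool_def)

context graph
begin

lemma finite_arcs_ends [simp]: "finite (arcs_ends G)"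
  by (simp add: arcs_ends_def)

lemma sum_arcs_ends_swap:
  "(\<Sum>(v, w) \<in> arcs_ends G. h w v) = (\<Sum>(v, w) \<in> arcs_ends G. h v w)"
  by (rule sum.reindex_bij_witness[where i = prod.swap and j = prod.swap])
    (auto intro: graph_symmetric)

lemma sum_mult_laplacian:
  "(\<Sum>v \<in> verts G. \<psi> v * laplacian G \<phi> v) = (\<Sum>(v, w) \<in> arcs_ends G. \<psi> v * (\<phi> v - \<phi> w))"
proof -
  have "arcs_ends G = Sigma (verts G) (\<lambda>v. {w \<in> verts G. v \<rightarrow>\<^bsub>G\<^esub> w})"
    by (auto dest: adj_in_verts)
  then show ?thesis
    by (simp add: laplacian_def sum_distrib_left sum.Sigma)
qed

text \<open>Summation by parts: each square splits into one term per end of the arc, and reversing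
  all arcs exchanges the two resulting sums.\<close>

lemma energy_eq_sum_laplacian:
  "energy G \<phi> = (\<Sum>v \<in> verts G. \<phi> v * laplacian G \<phi> v)"
proof -
  have "2 * energy G \<phi> = (\<Sum>(v, w) \<in> arcs_ends G. \<phi> v * (\<phi> v - \<phi> w))
      + (\<Sum>(v, w) \<in> arcs_ends G. \<phi> w * (\<phi> w - \<phi> v))"
    unfolding energy_def sum.distrib[symmetric]
    by (simp add: case_prod_unfold power2_eq_square algebra_simps)
  also have "(\<Sum>(v, w) \<in> arcs_ends G. \<phi> w * (\<phi> w - \<phi> v))
      = (\<Sum>(v, w) \<in> arcs_ends G. \<phi> v * (\<phi> v - \<phi> w))"
    by (rule sum_arcs_ends_swap)
  finally show ?thesis by (simp add: sum_mult_laplacian)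
qed

text \<open>Reversing all arcs turns the sum into its own negative.\<close>

lemma sum_laplacian: "(\<Sum>v \<in> verts G. laplacian G \<phi> v) = 0"
proof -
  have "(\<Sum>v \<in> verts G. laplacian G \<phi> v) = (\<Sum>(v, w) \<in> arcs_ends G. \<phi> v - \<phi> w)"
    using sum_mult_laplacian[of "\<lambda>_. 1"] by simp
  moreover have "(\<Sum>(v, w) \<in> arcs_ends G. \<phi> v - \<phi> w) = (\<Sum>(v, w) \<in> arcs_ends G. \<phi> w - \<phi> v)"
    by (rule sum_arcs_ends_swap)
  moreover have "\<dots> = - (\<Sum>(v, w) \<in> arcs_ends G. \<phi> v - \<phi> w)"
    by (simp add: sum_negf[symmetric] case_prod_unfold)
  ultimately show ?thesis by linarith
qed

lemma energy_zero_imp_eq: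
  assumes "energy G \<phi> = 0" "v \<rightarrow>\<^sup>*\<^bsub>G\<^esub> w"
  shows "\<phi> v = \<phi> w"
proof -
  have "\<phi> a = \<phi> b" if "a \<rightarrow>\<^bsub>G\<^esub> b" for a b
  proof -
    have "\<forall>e \<in> arcs_ends G. (case e of (v, w) \<Rightarrow> (\<phi> v - \<phi> w)\<^sup>2) = 0"
      using assms(1) unfolding energy_def by (subst sum_nonneg_eq_0_iff[symmetric]) auto
    with that show ?thesis by fastforce
  qed
  with assms(2) show ?thesis
    by (induct rule: converse_reachable_induct) auto
qed

text \<open>Only the terms at \<open>i\<close> and \<open>j\<close> survive in the sum of potential
  times Laplacian. Lower bounds on the energy thereby become inequalities for the voltage.\<close>

lemma energy_unit_current_potential:
  assumes "unit_current_potential G i j \<phi>" "i \<in> verts G" "j \<in> verts G"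
  shows "energy G \<phi> = \<phi> i - \<phi> j"
proof -
  have "energy G \<phi> = (\<Sum>v \<in> verts G. (if v = i then \<phi> i else 0) - (if v = j then \<phi> j else 0))"
    unfolding energy_eq_sum_laplacian using assms(1)
    by (intro sum.cong) (auto simp: unit_current_potential_laplacian)
  with assms(2,3) show ?thesis
    by (simp add: sum_subtractf)
qed

end

locale connected_graph = graph +
  assumes connected: "v \<in> verts G \<Longrightarrow> w \<in> verts G \<Longrightarrow> v \<rightarrow>\<^sup>*\<^bsub>G\<^esub> w"
begin

text \<open>The Laplacian is singular, since constants lie in its kernel. Adding the all-ones matrix
  makes it injective, and for a right-hand side of total 0 the added part vanishes on the
  solution.\<close>

lemma unit_current_potential_exists:
  assumes i: "i \<in> verts G" and j: "j \<in> verts G"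
  shows "\<exists>\<phi>. unit_current_potential G i j \<phi>"
proof -
  define a :: "'a \<Rightarrow> 'a \<Rightarrow> real" where "a v w = of_bool (v \<rightarrow>\<^bsub>G\<^esub> w)" for v w
  \<comment> \<open>Degree on the diagonal, minus adjacency, plus the all-ones matrix.\<close>
  define A where "A v w = (if v = w then \<Sum>z\<in>verts G. a v z else 0) - a v w + 1" for v w
  have lap: "(\<Sum>w\<in>verts G. A v w * \<phi> w) = laplacian G \<phi> v + (\<Sum>w\<in>verts G. \<phi> w)"
    if "v \<in> verts G" for v \<phi>
  proof -
    have "laplacian G \<phi> v = (\<Sum>w\<in>verts G. a v w * (\<phi> v - \<phi> w))"
      unfolding laplacian_def a_def by (rule sum.mono_neutral_cong_left) auto
    also have "\<dots> = (\<Sum>w\<in>verts G. a v w) * \<phi> v - (\<Sum>w\<in>verts G. a v w * \<phi> w)"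
      by (simp add: algebra_simps sum_subtractf sum_distrib_left)
    finally have *: "laplacian G \<phi> v = \<dots>" .
    have "(\<Sum>w\<in>verts G. A v w * \<phi> w) = (\<Sum>w\<in>verts G.
        (if v = w then (\<Sum>z\<in>verts G. a v z) * \<phi> v else 0) - a v w * \<phi> w + \<phi> w)"
      by (rule sum.cong) (auto simp: A_def algebra_simps)
    then show ?thesis
      using that unfolding * by (simp add: sum.distrib sum_subtractf)
  qed
  have card: "real (card (verts G)) \<noteq> 0"
    using i by auto
  \<comment> \<open>Adding up all rows cancels the Laplacian part and leaves the number of vertices
    times the total of \<phi>.\<close>
  have zero_sum: "(\<Sum>w\<in>verts G. \<phi> w) = 0"
    if "\<And>v. v \<in> verts G \<Longrightarrow> (\<Sum>w\<in>verts G. A v w * \<phi> w) = c v" "(\<Sum>v\<in>verts G. c v) = 0"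
    for \<phi> c
  proof -
    have "0 = (\<Sum>v\<in>verts G. \<Sum>w\<in>verts G. A v w * \<phi> w)"
      using that by simp
    also have "\<dots> = real (card (verts G)) * (\<Sum>w\<in>verts G. \<phi> w)"
      by (simp add: lap sum.distrib sum_laplacian)
    finally show ?thesis using card by simp
  qed
  \<comment> \<open>A kernel vector has total 0, so its Laplacian and its energy vanish; it is
    constant by connectedness, and a constant of total 0 is 0.\<close>
  have inj: "\<forall>v\<in>verts G. \<phi> v = 0" if ker: "\<forall>v\<in>verts G. (\<Sum>w\<in>verts G. A v w * \<phi> w) = 0" for \<phi>
  proof -
    have s: "(\<Sum>w\<in>verts G. \<phi> w) = 0"
      using zero_sum[of \<phi> "\<lambda>_. 0"] ker by simp
    then have "laplacian G \<phi> v = 0" if "v \<in> verts G" for v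
      using lap[OF that, of \<phi>] bspec[OF ker that] by simp
    then have "energy G \<phi> = 0"
      by (simp add: energy_eq_sum_laplacian)
    then have const: "\<phi> v = \<phi> i" if "v \<in> verts G" for v
      using energy_zero_imp_eq connected i that by blast
    then have "(\<Sum>w\<in>verts G. \<phi> w) = real (card (verts G)) * \<phi> i"
      by simp
    with s card const show ?thesis by simp
  qed
  obtain \<phi> where \<phi>:
    "\<forall>v\<in>verts G. (\<Sum>w\<in>verts G. A v w * \<phi> w) = of_bool (v = i) - of_bool (v = j)"
    using injective_square_system_solvable[OF finite_verts inj] by fast
  have "(\<Sum>v\<in>verts G. of_bool (v = i) - of_bool (v = j) :: real) = 0"
    using i j by (simp add: sum_subtractf of_bool_def)
  with \<phi> have s: "(\<Sum>w\<in>verts G. \<phi> w) = 0"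
    using zero_sum[of \<phi> "\<lambda>v. of_bool (v = i) - of_bool (v = j)"] by blast
  have "laplacian G \<phi> v = of_bool (v = i) - of_bool (v = j)" if "v \<in> verts G" for v
    using lap[OF that, of \<phi>] bspec[OF \<phi> that] s by linarith
  then show ?thesis
    unfolding unit_current_potential_laplacian by blast
qed

text \<open>The difference of two potentials has zero Laplacian, hence zero energy, hence equal
  values at \<open>i\<close> and \<open>j\<close>. This is the uniqueness that \<open>THE\<close>
  requires.\<close>

lemma resistance_distance_eq:
  assumes "unit_current_potential G i j \<phi>" and i: "i \<in> verts G" and j: "j \<in> verts G"
  shows "resistance_distance G i j = \<phi> i - \<phi> j"
  unfolding resistance_distance_def
proof (rule the_equality)
  show "\<exists>\<psi>. unit_current_potential G i j \<psi> \<and> \<phi> i - \<phi> j = \<psi> i - \<psi> j"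
    using assms(1) by blast
next
  fix r
  assume "\<exists>\<psi>. unit_current_potential G i j \<psi> \<and> r = \<psi> i - \<psi> j"
  then obtain \<psi> where \<psi>: "unit_current_potential G i j \<psi>" "r = \<psi> i - \<psi> j"
    by blast
  let ?d = "\<lambda>v. \<phi> v - \<psi> v"
  have "laplacian G ?d v = laplacian G \<phi> v - laplacian G \<psi> v" for v
    unfolding laplacian_def sum_subtractf[symmetric] by (rule sum.cong) auto
  then have "energy G ?d = 0"
    using assms(1) \<psi>(1)
    by (simp add: energy_eq_sum_laplacian unit_current_potential_laplacian)
  from energy_zero_imp_eq[OF this connected[OF i j]] show "r = \<phi> i - \<phi> j"
    using \<psi>(2) by simp
qed

end

section \<open>Resistance along a cycle\<close>

text \<open>Each step is counted in one direction only, so no halving occurs as it does in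
  \<open>energy\<close>.\<close>

definition path_energy :: "('a \<Rightarrow> real) \<Rightarrow> 'a list \<Rightarrow> real" where
  "path_energy \<phi> xs = (\<Sum>(x, y) \<leftarrow> zip xs (tl xs). (\<phi> x - \<phi> y)\<^sup>2)"

lemma path_energy_simps [simp]:
  "path_energy \<phi> [] = 0"
  "path_energy \<phi> [x] = 0"
  "path_energy \<phi> (x # y # xs) = (\<phi> x - \<phi> y)\<^sup>2 + path_energy \<phi> (y # xs)"
  by (simp_all add: path_energy_def)

lemma path_energy_append:
  "path_energy \<phi> (xs @ v # ys) = path_energy \<phi> (xs @ [v]) + path_energy \<phi> (v # ys)"
  by (induct xs rule: induct_list012) auto

text \<open>The induction step of the Cauchy-Schwarz inequality for a sum of differences; it comes
  from \<open>(m * a - b)\<^sup>2\<close> being nonnegative, after cancelling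
  \<open>m\<close>.\<close>

lemma square_add_le_of_square_le:
  fixes a b m B :: real
  assumes b: "b\<^sup>2 \<le> m * B" and m: "0 \<le> m" and B: "0 \<le> B"
  shows "(a + b)\<^sup>2 \<le> (m + 1) * (a\<^sup>2 + B)"
proof (cases "m = 0")
  case True
  with b B show ?thesis by simp
next
  case False
  have "0 \<le> (m * a - b)\<^sup>2" by simp
  with b have "m * (2 * a * b) \<le> m * (m * a\<^sup>2 + B)"
    by (simp add: power2_eq_square algebra_simps)
  with False m have "2 * a * b \<le> m * a\<^sup>2 + B" by simp
  with b show ?thesis
    by (simp add: power2_eq_square algebra_simps)
qed

lemma path_energy_nonneg: "0 \<le> path_energy \<phi> xs"
  by (induct xs rule: induct_list012) auto

text \<open>Cauchy-Schwarz for the telescoping sum of the differences; \<open>length xs - 1\<close>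
  is the number of edges.\<close>

lemma potential_difference_le_path_energy:
  assumes "xs \<noteq> []"
  shows "(\<phi> (hd xs) - \<phi> (last xs))\<^sup>2 \<le> real (length xs - 1) * path_energy \<phi> xs"
  using assms
proof (induct xs rule: induct_list012)
  case (3 x y zs)
  then have "(\<phi> y - \<phi> (last (y # zs)))\<^sup>2 \<le> real (length zs) * path_energy \<phi> (y # zs)"
    by simp
  from square_add_le_of_square_le[OF this _ path_energy_nonneg, of "\<phi> x - \<phi> y"]
  show ?case by (simp add: algebra_simps)
qed auto

lemma successively_iff_zip:
  "successively P xs \<longleftrightarrow> (\<forall>(x, y) \<in> set (zip xs (tl xs)). P x y)"
  by (induct xs rule: induct_list012) auto

text \<open>The base point \<open>u\<close> is kept out of \<open>ds\<close>. The bound on the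
  length makes the cycle have at least three vertices and so excludes an edge traversed back and
  forth.\<close>

definition cycle_at :: "('a, 'b) pre_digraph \<Rightarrow> 'a \<Rightarrow> 'a list \<Rightarrow> bool" where
  "cycle_at G u ds \<longleftrightarrow>
     distinct (u # ds) \<and> 2 \<le> length ds \<and> successively (dominates G) (u # ds @ [u])"

lemma cycle_at_nth_adj:
  assumes "cycle_at G u ds" "i < Suc (length ds)"
  shows "(u # ds) ! i \<rightarrow>\<^bsub>G\<^esub> (u # ds) ! (Suc i mod Suc (length ds))"
proof -
  have "((u # ds @ [u]) ! i, (ds @ [u]) ! i) \<in> set (zip (u # ds @ [u]) (ds @ [u]))"
    using assms(2) by (auto simp: set_zip simp del: nth_Cons_Suc)
  moreover have "(u # ds @ [u]) ! i = (u # ds) ! i"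
    using assms(2) by (simp add: nth_append flip: append_Cons)
  moreover have "(ds @ [u]) ! i = (u # ds) ! (Suc i mod Suc (length ds))"
    using assms(2) by (cases "i = length ds") (auto simp: nth_append)
  ultimately show ?thesis
    using assms(1) by (auto simp: cycle_at_def successively_iff_zip)
qed

context graph
begin

lemma cycle_at_in_verts:
  assumes "cycle_at G u ds"
  shows "set (u # ds) \<subseteq> verts G"
proof
  fix x
  assume "x \<in> set (u # ds)"
  then obtain i where "i < Suc (length ds)" "x = (u # ds) ! i"
    by (metis in_set_conv_nth length_Cons)
  with cycle_at_nth_adj[OF assms] show "x \<in> verts G"
    using adj_in_verts(1) by metis
qed

text \<open>The arcs of the cycle and their reverses are disjoint sets of arcs of \<open>G\<close>
  with the same sum of squares, which compensates for the halving in \<open>energy\<close>.\<close>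

lemma cycle_at_energy_le:
  assumes "cycle_at G u ds"
  shows "path_energy \<phi> (u # ds @ [u]) \<le> energy G \<phi>"
proof -
  define c where "c = u # ds"
  define m where "m = length c"
  have dc: "distinct c" and m: "3 \<le> m"
    using assms by (auto simp: cycle_at_def c_def m_def)
  define S where "S = (\<lambda>i. (c ! i, c ! (Suc i mod m))) ` {..<m}"
  have lens: "length c = m" "length (ds @ [u]) = m"
    by (simp_all add: m_def c_def)
  let ?q = "\<lambda>(x, y). (\<phi> x - \<phi> y)\<^sup>2"
  have inj: "inj_on (\<lambda>i. (c ! i, c ! (Suc i mod m))) {..<m}"
    using dc by (auto simp: inj_on_def nth_eq_iff_index_eq m_def)
  have S_arcs: "S \<subseteq> arcs_ends G"
    using cycle_at_nth_adj[OF assms] by (auto simp: S_def c_def m_def)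
  \<comment> \<open>The closing \<open>u\<close> has no successor, so \<open>zip\<close> drops
    it.\<close>
  have "path_energy \<phi> (u # ds @ [u]) = (\<Sum>e \<leftarrow> zip c (ds @ [u]). ?q e)"
    using zip_append[of c "ds @ [u]" "[u]" "[]"] by (simp add: path_energy_def c_def)
  also have "zip c (ds @ [u]) = map (\<lambda>i. (c ! i, c ! (Suc i mod m))) [0..<m]"
  proof (rule nth_equalityI)
    fix i
    assume "i < length (zip c (ds @ [u]))"
    then have i: "i < m" by (simp add: m_def c_def)
    have "(ds @ [u]) ! i = c ! (Suc i mod m)"
      using i by (cases "i = length ds") (auto simp: nth_append c_def m_def)
    then show "zip c (ds @ [u]) ! i = map (\<lambda>i. (c ! i, c ! (Suc i mod m))) [0..<m] ! i"
      using i lens by simp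
  qed (simp add: m_def c_def)
  also have "(\<Sum>e \<leftarrow> \<dots>. ?q e) = (\<Sum>e \<in> S. ?q e)"
    unfolding S_def sum.reindex[OF inj]
    by (simp add: comp_def interv_sum_list_conv_sum_set_nat lessThan_atLeast0)
  finally have eq: "path_energy \<phi> (u # ds @ [u]) = (\<Sum>e \<in> S. ?q e)" .
  \<comment> \<open>A common arc would make two positions cyclic successors of each other, which is
    impossible when \<open>m\<close> is at least 3.\<close>
  have "S \<inter> prod.swap ` S = {}"
  proof (rule ccontr)
    assume "S \<inter> prod.swap ` S \<noteq> {}"
    then obtain i j where ij: "i < m" "j < m"
      and "c ! i = c ! (Suc j mod m)" "c ! (Suc i mod m) = c ! j"
      by (auto simp: S_def)
    moreover have "Suc i mod m < m" "Suc j mod m < m"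
      using m by simp_all
    ultimately have "Suc j mod m = i" "Suc i mod m = j"
      using nth_eq_iff_index_eq[OF dc] lens(1) by metis+
    with ij have "Suc j = m \<and> i = 0 \<or> i = Suc j" "Suc i = m \<and> j = 0 \<or> j = Suc i"
      by (auto simp: mod_Suc split: if_splits)
    with m show False by arith
  qed
  then have "(\<Sum>e \<in> S. ?q e) + (\<Sum>e \<in> prod.swap ` S. ?q e) = (\<Sum>e \<in> S \<union> prod.swap ` S. ?q e)"
    by (intro sum.union_disjoint[symmetric]) (auto simp: S_def)
  also have "\<dots> \<le> (\<Sum>e \<in> arcs_ends G. ?q e)"
    using S_arcs by (intro sum_mono2) (auto intro: graph_symmetric)
  also have "(\<Sum>e \<in> prod.swap ` S. ?q e) = (\<Sum>e \<in> S. ?q e)"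
    by (subst sum.reindex) (auto simp: inj_on_def case_prod_unfold power2_commute)
  finally show ?thesis
    by (simp add: eq energy_def)
qed

end

context connected_graph
begin

text \<open>The two arcs of the cycle are parallel resistors.\<close>

lemma resistance_distance_le_cycle:
  assumes "cycle_at G u (xs @ v # ys)"
  shows "resistance_distance G u v
    \<le> real (Suc (length xs)) * real (Suc (length ys)) / real (Suc (length xs) + Suc (length ys))"
proof -
  have uv: "u \<in> verts G" "v \<in> verts G"
    using cycle_at_in_verts[OF assms] by auto
  then obtain \<phi> where \<phi>: "unit_current_potential G u v \<phi>"
    using unit_current_potential_exists by blast
  define r where "r = \<phi> u - \<phi> v"
  define a b where "a = real (Suc (length xs))" and "b = real (Suc (length ys))"
  define P Q where "P = path_energy \<phi> (u # xs @ [v])" and "Q = path_energy \<phi> (v # ys @ [u])"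
  have ab: "a > 0" "b > 0"
    by (simp_all add: a_def b_def)
  \<comment> \<open>The total energy is the voltage \<open>r\<close>, and the two arcs of the cycle
    share no edge.\<close>
  have "P + Q \<le> r"
    using cycle_at_energy_le[OF assms, of \<phi>] energy_unit_current_potential[OF \<phi> uv]
      path_energy_append[of \<phi> "u # xs" v "ys @ [u]"]
    by (simp add: P_def Q_def r_def)
  moreover have "0 \<le> P" "0 \<le> Q"
    by (simp_all add: P_def Q_def path_energy_nonneg)
  moreover have "r\<^sup>2 \<le> a * P" "r\<^sup>2 \<le> b * Q"
    using potential_difference_le_path_energy[of "u # xs @ [v]" \<phi>]
      potential_difference_le_path_energy[of "v # ys @ [u]" \<phi>]
    by (simp_all add: a_def b_def P_def Q_def r_def power2_commute)
  \<comment> \<open>Adding the two Cauchy-Schwarz bounds, scaled by \<open>b\<close> and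
    \<open>a\<close>, gives \<open>r\<^sup>2 * (a + b) \<le> a * b * r\<close>; it remains to cancel
    \<open>r\<close>.\<close>
  ultimately have r: "0 \<le> r" and "r\<^sup>2 * b \<le> a * P * b" "r\<^sup>2 * a \<le> b * Q * a" "a * b * (P + Q) \<le> a * b * r"
    using ab by auto
  then have "r * (r * (a + b)) \<le> r * (a * b)"
    by (simp add: power2_eq_square algebra_simps)
  with r ab have "r * (a + b) \<le> a * b"
    by (cases "r = 0") auto
  then have "r \<le> a * b / (a + b)"
    using ab by (simp add: field_simps)
  with resistance_distance_eq[OF \<phi> uv] show ?thesis
    by (simp add: r_def a_def b_def)
qed

end

section \<open>Growing the graph by ears\<close>

lemma sum_linear_product:
  fixes P Q :: real
  shows "(\<Sum>i<k. (P + real i) * (Q - real i)) =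
    real k * P * Q + (Q - P) * (real k * (real k - 1) / 2)
      - (real k - 1) * real k * (2 * real k - 1) / 6"
  by (induct k) (simp_all add: field_simps)

text \<open>The bounds \<open>j (m - j) / m\<close> over \<open>k\<close> consecutive vertices of a
  cycle with \<open>m = p + q + k + 1\<close>, where \<open>p\<close> and \<open>q\<close> count the
  vertices between \<open>u\<close> and the segment on its two sides.\<close>

lemma sum_cycle_segment:
  "(\<Sum>i<k. real (Suc (p + i)) * real (q + k - i) / real (Suc (p + q + k))) =
    real k * (6 * real p * real q + 3 * real p * real k + 3 * real q * real k + 3 * real p
      + 3 * real q + real k ^ 2 + 3 * real k + 2) / (6 * real (Suc (p + q + k)))"
proof -
  have "(\<Sum>i<k. real (Suc (p + i)) * real (q + k - i)) =
      (\<Sum>i<k. (real (Suc p) + real i) * (real (q + k) - real i))"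
    by (rule sum.cong) (auto simp: of_nat_diff)
  also have "\<dots> = real k * (6 * real p * real q + 3 * real p * real k + 3 * real q * real k
      + 3 * real p + 3 * real q + real k ^ 2 + 3 * real k + 2) / 6"
    unfolding sum_linear_product by (simp add: field_simps power2_eq_square)
  finally show ?thesis
    unfolding sum_divide_distrib[symmetric] by (simp only: divide_divide_eq_left)
qed

text \<open>The case \<open>p = q = 0\<close>, in which the segment is the whole cycle except
  \<open>u\<close>.\<close>

lemma sum_cycle:
  "(\<Sum>i<k. real (Suc i) * real (k - i) / real (Suc k)) = (real (Suc k) ^ 2 - 1) / 6"
proof -
  have "(\<Sum>i<k. real (Suc i) * real (k - i) / real (Suc k))
      = real k * (real k ^ 2 + 3 * real k + 2) / (6 * real (Suc k))"
    using sum_cycle_segment[where p = 0 and q = 0 and k = k] by simp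
  also have "\<dots> = (real (Suc k) ^ 2 - 1) / 6"
    by (simp add: field_simps power2_eq_square)
  finally show ?thesis .
qed

text \<open>For \<open>n = p + q + 1\<close> the difference of the two sides is a positive multiple of \<open>(p - q)\<^sup>2 + p\<^sup>2 + q\<^sup>2 + p + q\<close>.\<close>

lemma sum_cycle_segment_less:
  assumes "0 < k" "0 < p + q" "Suc (p + q) \<le> n"
  shows "(\<Sum>i<k. real (Suc (p + i)) * real (q + k - i) / real (Suc (p + q + k)))
    < (2 * real n * real k + real k ^ 2) / 6"
proof -
  define x y z where "x = real p" and "y = real q" and "z = real k"
  have nonneg: "0 \<le> x" "0 \<le> y" "0 < z" "0 < x + y"
    using assms by (auto simp: x_def y_def z_def)
  have "0 < (x - y)\<^sup>2 + x\<^sup>2 + y\<^sup>2 + (x + y)"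
    using nonneg by (simp add: add_nonneg_pos)
  then have "6 * x * y + 3 * x * z + 3 * y * z + 3 * x + 3 * y + z ^ 2 + 3 * z + 2
      < (2 * (x + y + 1) + z) * (x + y + 1 + z)"
    by (simp add: power2_eq_square algebra_simps)
  then have "z * (6 * x * y + 3 * x * z + 3 * y * z + 3 * x + 3 * y + z ^ 2 + 3 * z + 2)
        / (6 * (x + y + 1 + z))
      < z * ((2 * (x + y + 1) + z) * (x + y + 1 + z)) / (6 * (x + y + 1 + z))"
    using nonneg by (intro divide_strict_right_mono mult_strict_left_mono) auto
  also have "\<dots> = z * (2 * (x + y + 1) + z) / 6"
    using nonneg by (simp add: field_simps)
  \<comment> \<open>The cycle may miss some of the \<open>n\<close> old vertices; the bound
    increases with their number.\<close>
  also have "\<dots> \<le> z * (2 * real n + z) / 6"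
    using nonneg assms(3) by (intro divide_right_mono mult_left_mono) (auto simp: x_def y_def)
  finally show ?thesis
    unfolding sum_cycle_segment x_def y_def z_def
    by (simp add: algebra_simps power2_eq_square)
qed

section \<open>Paths, ears and the invariant of the ear construction\<close>

definition simple_path :: "('a, 'b) pre_digraph \<Rightarrow> 'a set \<Rightarrow> 'a \<Rightarrow> 'a \<Rightarrow> 'a list \<Rightarrow> bool" where
  "simple_path G W x y xs \<longleftrightarrow> xs \<noteq> [] \<and> hd xs = x \<and> last xs = y \<and> distinct xs \<and> set xs \<subseteq> W
     \<and> successively (dominates G) xs"

text \<open>The invariant of the construction: whatever the ends of the next ear, it can be closed
  up to a cycle through \<open>u\<close>.\<close>

definition joined_through :: "('a, 'b) pre_digraph \<Rightarrow> 'a \<Rightarrow> 'a set \<Rightarrow> bool" where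
  "joined_through G u W \<longleftrightarrow>
     (\<forall>x \<in> W. \<forall>y \<in> W. x \<noteq> y \<longrightarrow> (\<exists>xs. simple_path G W x y xs \<and> u \<in> set xs))"

text \<open>\<open>ns\<close> holds only the inner vertices, all of them new; since it is nonempty,
  chords are not ears and every ear enlarges \<open>W\<close>.\<close>

definition ear :: "('a, 'b) pre_digraph \<Rightarrow> 'a set \<Rightarrow> 'a \<Rightarrow> 'a list \<Rightarrow> 'a \<Rightarrow> bool" where
  "ear G W x ns y \<longleftrightarrow> x \<in> W \<and> y \<in> W \<and> x \<noteq> y \<and> ns \<noteq> [] \<and> distinct ns \<and> set ns \<inter> W = {}
     \<and> successively (dominates G) (x # ns @ [y])"

lemma joined_throughE:
  assumes "joined_through G u W" "x \<in> W" "y \<in> W" "x \<noteq> y"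
  obtains xs where "simple_path G W x y xs" "u \<in> set xs"
  using assms unfolding joined_through_def by blast

lemma simple_path_mono:
  "simple_path G W x y xs \<Longrightarrow> W \<subseteq> W' \<Longrightarrow> simple_path G W' x y xs"
  by (auto simp: simple_path_def)

lemma simple_path_append:
  assumes "simple_path G W x y xs" "simple_path G W' y' z ys" "y \<rightarrow>\<^bsub>G\<^esub> y'" "W \<inter> W' = {}"
  shows "simple_path G (W \<union> W') x z (xs @ ys)"
  using assms by (auto simp: simple_path_def successively_append_iff)

text \<open>The path is built from the end of the walk backwards: it restarts whenever the next
  vertex of the walk lies in \<open>W\<close>, and a repeated vertex cuts off a loop.\<close>

lemma (in wf_digraph) first_hit_path:
  assumes "x \<rightarrow>\<^sup>*\<^bsub>G\<^esub> z" "x \<notin> W" "z \<in> W"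
  shows "\<exists>ns y. ns \<noteq> [] \<and> hd ns = x \<and> distinct ns \<and> set ns \<inter> W = {} \<and> y \<in> W
    \<and> successively (dominates G) (ns @ [y])"
  using assms
proof (induct rule: converse_reachable_induct)
  case base
  then show ?case by simp
next
  case (step x x')
  show ?case
  proof (cases "x' \<in> W")
    case True
    with step show ?thesis
      by (intro exI[of _ "[x]"] exI[of _ x']) auto
  next
    case False
    with step obtain ns y where ns: "ns \<noteq> []" "hd ns = x'" "distinct ns" "set ns \<inter> W = {}" "y \<in> W"
      "successively (dominates G) (ns @ [y])"
      by blast
    show ?thesis
    proof (cases "x \<in> set ns")
      case True
      then obtain ps qs where "ns = ps @ x # qs"
        by (meson split_list)
      with ns show ?thesis
        by (intro exI[of _ "x # qs"] exI[of _ y]) (auto simp: successively_append_iff)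
    next
      case False
      with ns step show ?thesis
        by (intro exI[of _ "x # ns"] exI[of _ y]) (auto simp: successively_Cons)
    qed
  qed
qed

context graph
begin

lemma successively_adj_rev:
  "successively (dominates G) (rev xs) \<longleftrightarrow> successively (dominates G) xs"
proof -
  have "successively (dominates G) (rev xs)" if "successively (dominates G) xs" for xs
    using that unfolding successively_rev by (rule successively_mono) (auto intro: graph_symmetric)
  from this[of xs] this[of "rev xs"] show ?thesis by auto
qed

lemma simple_path_rev: "simple_path G W x y xs \<Longrightarrow> simple_path G W y x (rev xs)"
  by (simp add: simple_path_def successively_adj_rev hd_rev last_rev del: successively_rev)

lemma ear_rev: "ear G W x ns y \<Longrightarrow> ear G W y (rev ns) x"
  using successively_adj_rev[of "x # ns @ [y]"] by (auto simp: ear_def)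

text \<open>From \<open>a\<close> a path inside \<open>W\<close> through \<open>u\<close> leads to
  one end of the ear, and the ear itself leads on to \<open>b\<close>. If \<open>a\<close> is the
  end \<open>x\<close>, the reversed ear is used.\<close>

lemma simple_path_into_ear:
  assumes ear: "ear G W x ns y" and J: "joined_through G u W" and a: "a \<in> W" and b: "b \<in> set ns"
  shows "\<exists>xs. simple_path G (W \<union> set ns) a b xs \<and> u \<in> set xs"
proof -
  have main: "\<exists>xs. simple_path G (W \<union> set ns) a b xs \<and> u \<in> set xs"
    if ear: "ear G W x ns y" and ax: "a \<noteq> x" and b: "b \<in> set ns" for x ns y
  proof -
    obtain ps qs where ns: "ns = ps @ b # qs"
      using b by (meson split_list)
    obtain xs where xs: "simple_path G W a x xs" "u \<in> set xs"
      using joined_throughE[OF J a _ ax] ear unfolding ear_def by blast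
    have "simple_path G (set ns) (hd (ps @ [b])) b (ps @ [b])"
      using ear by (auto simp: ear_def simple_path_def ns successively_Cons successively_append_iff)
    moreover have "x \<rightarrow>\<^bsub>G\<^esub> hd (ps @ [b])"
      using ear by (cases ps) (auto simp: ear_def ns)
    moreover have "W \<inter> set ns = {}"
      using ear by (auto simp: ear_def)
    ultimately have "simple_path G (W \<union> set ns) a b (xs @ ps @ [b])"
      by (rule simple_path_append[OF xs(1)])
    with xs(2) show ?thesis by (intro exI[of _ "xs @ ps @ [b]"]) simp
  qed
  show ?thesis
  proof (cases "a = x")
    case True
    with ear have "a \<noteq> y" by (auto simp: ear_def)
    from main[OF ear_rev[OF ear] this] b show ?thesis by simp
  qed (use main[OF ear] b in auto)
qed

text \<open>The path runs from \<open>a\<close> back to \<open>x\<close>, through \<open>W\<close>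
  by way of \<open>u\<close> to \<open>y\<close>, and backwards along the ear to \<open>b\<close>,
  avoiding the stretch \<open>qs\<close>.\<close>

lemma simple_path_around_ear:
  assumes ear: "ear G W x (ps @ a # qs @ b # rs) y" and J: "joined_through G u W"
  shows "\<exists>xs. simple_path G (W \<union> set (ps @ a # qs @ b # rs)) a b xs \<and> u \<in> set xs"
proof -
  obtain xs where xs: "simple_path G W x y xs" "u \<in> set xs"
    using joined_throughE[OF J] ear unfolding ear_def by metis
  have "successively (dominates G) (rev (x # (ps @ a # qs @ b # rs) @ [y]))"
    using ear unfolding successively_adj_rev by (simp add: ear_def)
  \<comment> \<open>Two ways of cutting the reversed ear: one exposes the piece from
    \<open>a\<close> to \<open>x\<close>, the other the piece from \<open>y\<close> to
    \<open>b\<close>.\<close>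
  moreover have "rev (x # (ps @ a # qs @ b # rs) @ [y])
      = (y # rev rs @ b # rev qs) @ (a # rev ps) @ [x]"
    "rev (x # (ps @ a # qs @ b # rs) @ [y])
      = [y] @ (rev rs @ [b]) @ rev qs @ (a # rev ps) @ [x]"
    by simp_all
  ultimately have succ: "successively (dominates G) (a # rev ps)" "last (a # rev ps) \<rightarrow>\<^bsub>G\<^esub> x"
      "successively (dominates G) (rev rs @ [b])" "y \<rightarrow>\<^bsub>G\<^esub> hd (rev rs @ [b])"
    by (metis append_is_Nil_conv hd_append2 last_ConsL list.discI list.sel(1) successively_append_iff)+
  have p: "simple_path G (set (a # ps)) a (last (a # rev ps)) (a # rev ps)"
    using ear succ by (auto simp: ear_def simple_path_def)
  have "set (a # ps) \<inter> W = {}"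
    using ear by (auto simp: ear_def)
  note 1 = simple_path_append[OF p xs(1) succ(2) this]
  have q: "simple_path G (set (b # rs)) (hd (rev rs @ [b])) b (rev rs @ [b])"
    using ear succ by (auto simp: ear_def simple_path_def)
  have "(set (a # ps) \<union> W) \<inter> set (b # rs) = {}"
    using ear by (auto simp: ear_def)
  from simple_path_append[OF 1 q succ(4) this] have "simple_path G (W \<union> set (ps @ a # qs @ b # rs)) a b
      (((a # rev ps) @ xs) @ (rev rs @ [b]))"
    by (rule simple_path_mono) auto
  with xs(2) show ?thesis
    by (intro exI[of _ "((a # rev ps) @ xs) @ (rev rs @ [b])"]) simp
qed

lemma joined_through_ear:
  assumes ear: "ear G W x ns y" and J: "joined_through G u W"
  shows "joined_through G u (W \<union> set ns)"
  unfolding joined_through_def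
proof (intro ballI impI)
  fix a b
  assume a: "a \<in> W \<union> set ns" and b: "b \<in> W \<union> set ns" and "a \<noteq> b"
  consider "a \<in> W" "b \<in> W" | "a \<in> W" "b \<in> set ns" | "a \<in> set ns" "b \<in> W"
    | "a \<in> set ns" "b \<in> set ns"
    using a b by blast
  then show "\<exists>xs. simple_path G (W \<union> set ns) a b xs \<and> u \<in> set xs"
  proof cases
    case 1
    with J \<open>a \<noteq> b\<close> obtain xs where xs: "simple_path G W a b xs" "u \<in> set xs"
      by (elim joined_throughE)
    then show ?thesis
      using simple_path_mono[OF xs(1) Un_upper1] by blast
  next
    case 2
    with simple_path_into_ear[OF ear J] show ?thesis by blast
  next
    case 3
    with simple_path_into_ear[OF ear J] obtain xs
      where xs: "simple_path G (W \<union> set ns) b a xs" "u \<in> set xs" by blast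
    then show ?thesis
      using simple_path_rev[OF xs(1)] by (intro exI[of _ "rev xs"]) auto
  next
    case 4
    then obtain ps ss where ns: "ns = ps @ a # ss"
      by (meson split_list)
    consider "b \<in> set ss" | "b \<in> set ps"
      using 4 \<open>a \<noteq> b\<close> ns by auto
    then show ?thesis
    proof cases
      case 1
      then obtain qs rs where "ss = qs @ b # rs"
        by (meson split_list)
      with simple_path_around_ear[OF _ J] ear ns show ?thesis by blast
    next
      case 2
      \<comment> \<open>Here \<open>b\<close> precedes \<open>a\<close> on the ear, so a path from
        \<open>b\<close> to \<open>a\<close> is found and then reversed.\<close>
      then obtain qs rs where "ps = qs @ b # rs"
        by (meson split_list)
      with simple_path_around_ear[of W x qs b rs a ss y, OF _ J] ear ns
      obtain xs where xs: "simple_path G (W \<union> set ns) b a xs" "u \<in> set xs" by auto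
      then show ?thesis
        using simple_path_rev[OF xs(1)] by (intro exI[of _ "rev xs"]) auto
    qed
  qed
qed

text \<open>A path in \<open>W\<close> from \<open>y\<close> to \<open>x\<close> through
  \<open>u\<close> closes the ear. Read from \<open>u\<close>, the cycle passes \<open>bs\<close> up
  to \<open>x\<close>, then the ear, then \<open>as\<close> beginning at \<open>y\<close>.\<close>

lemma cycle_through_ear:
  assumes ear: "ear G W x ns y" and J: "joined_through G u W"
  obtains as bs where "cycle_at G u (bs @ ns @ as)" "distinct (as @ u # bs)" "set (as @ u # bs) \<subseteq> W"
    "x \<in> set (as @ u # bs)" "y \<in> set (as @ u # bs)"
proof -
  obtain xs where xs: "simple_path G W y x xs" "u \<in> set xs"
    using joined_throughE[OF J] ear unfolding ear_def by metis
  then obtain as bs where split: "xs = as @ u # bs"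
    by (meson split_list)
  have ends: "hd (as @ [u]) = y" "last (u # bs) = x"
    using xs(1) by (auto simp: simple_path_def split hd_append)
  have mem: "x \<in> set xs" "y \<in> set xs"
    using xs(1) by (auto simp: simple_path_def)
  \<comment> \<open>Otherwise both ends of the ear would be \<open>u\<close>.\<close>
  have "as \<noteq> [] \<or> bs \<noteq> []"
    using ends ear by (auto simp: ear_def)
  then have "2 \<le> length (bs @ ns @ as)"
    using ear by (cases as; cases bs; cases ns) (auto simp: ear_def)
  moreover have "distinct (u # bs @ ns @ as)"
    using xs(1) ear by (auto simp: simple_path_def ear_def split)
  moreover have "successively (dominates G) (u # (bs @ ns @ as) @ [u])"
  proof -
    have "successively (dominates G) ((u # bs) @ ns @ (as @ [u]))"
      using xs(1) ear ends unfolding successively_append_iff[of _ "u # bs"] successively_append_iff[of _ ns]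
      by (auto simp: simple_path_def ear_def split successively_append_iff successively_Cons hd_append
          split: if_splits)
    then show ?thesis by simp
  qed
  ultimately show ?thesis
    using that[of bs as] xs(1) mem by (auto simp: cycle_at_def simple_path_def split)
qed

end

section \<open>Resistance sums over cycles and ears\<close>

context connected_graph
begin

text \<open>As \<open>u\<close> itself is not in \<open>ds\<close>, position \<open>i\<close> is
  \<open>Suc i\<close> steps away from \<open>u\<close>.\<close>

lemma resistance_distance_nth_le:
  assumes "cycle_at G u ds" "i < length ds"
  shows "resistance_distance G u (ds ! i)
    \<le> real (Suc i) * real (length ds - i) / real (Suc (length ds))"
proof -
  have "cycle_at G u (take i ds @ ds ! i # drop (Suc i) ds)"
    using assms id_take_nth_drop by metis
  from resistance_distance_le_cycle[OF this] assms(2) show ?thesis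
    by (simp add: min_def of_nat_diff algebra_simps)
qed

lemma sum_resistance_cycle_segment_le:
  assumes "cycle_at G u (bs @ ns @ as)"
  shows "(\<Sum>v \<in> set ns. resistance_distance G u v) \<le>
    (\<Sum>i < length ns. real (Suc (length bs + i)) * real (length as + length ns - i)
      / real (Suc (length bs + length as + length ns)))"
proof -
  have "distinct ns"
    using assms by (auto simp: cycle_at_def)
  then have "(\<Sum>v \<in> set ns. resistance_distance G u v)
      = (\<Sum>i < length ns. resistance_distance G u (ns ! i))"
    by (intro sum.reindex_bij_betw[symmetric] bij_betw_nth) auto
  also have "\<dots> \<le> (\<Sum>i < length ns. real (Suc (length bs + i)) * real (length as + length ns - i)
      / real (Suc (length bs + length as + length ns)))"
  proof (rule sum_mono)
    fix i
    assume "i \<in> {..<length ns}"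
    then have i: "i < length ns" by simp
    from resistance_distance_nth_le[OF assms, of "length bs + i"] i
    show "resistance_distance G u (ns ! i)
        \<le> real (Suc (length bs + i)) * real (length as + length ns - i)
          / real (Suc (length bs + length as + length ns))"
      by (simp add: nth_append add_ac)
  qed
  finally show ?thesis .
qed

lemma resistance_distance_self: "u \<in> verts G \<Longrightarrow> resistance_distance G u u = 0"
  using resistance_distance_eq unit_current_potential_exists by fastforce

lemma sum_resistance_cycle_le:
  assumes "cycle_at G u ds"
  shows "(\<Sum>v \<in> set (u # ds). resistance_distance G u v) \<le> (real (length (u # ds)) ^ 2 - 1) / 6"
proof -
  have "u \<in> verts G"
    using cycle_at_in_verts[OF assms] by simp
  then have "(\<Sum>v \<in> set (u # ds). resistance_distance G u v) = (\<Sum>v \<in> set ds. resistance_distance G u v)"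
    using assms by (simp add: cycle_at_def resistance_distance_self)
  also have "\<dots> \<le> (\<Sum>i < length ds. real (Suc i) * real (length ds - i) / real (Suc (length ds)))"
    using sum_resistance_cycle_segment_le[of u "[]" ds "[]"] assms by simp
  also have "\<dots> = (real (length (u # ds)) ^ 2 - 1) / 6"
    unfolding sum_cycle by simp
  finally show ?thesis .
qed

text \<open>The estimate for the new vertices is strict and its right-hand side is exactly the
  growth of the bound, so strictness appears even if \<open>W\<close> attained equality.\<close>

lemma sum_resistance_ear_less:
  assumes ear: "ear G W x ns y" and J: "joined_through G u W" and fin: "finite W"
    and le: "(\<Sum>v \<in> W. resistance_distance G u v) \<le> (real (card W) ^ 2 - 1) / 6"
  shows "(\<Sum>v \<in> W \<union> set ns. resistance_distance G u v) < (real (card (W \<union> set ns)) ^ 2 - 1) / 6"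
proof -
  obtain as bs where c: "cycle_at G u (bs @ ns @ as)" "distinct (as @ u # bs)" "set (as @ u # bs) \<subseteq> W"
    "x \<in> set (as @ u # bs)" "y \<in> set (as @ u # bs)"
    using cycle_through_ear[OF ear J] .
  have ns: "0 < length ns" "distinct ns" "W \<inter> set ns = {}" "x \<noteq> y"
    using ear by (auto simp: ear_def)
  have "length (as @ u # bs) \<le> card W"
    using c(2,3) fin by (metis card_mono distinct_card)
  then have n: "Suc (length bs + length as) \<le> card W"
    by simp
  \<comment> \<open>The two distinct ends of the ear lie on the cycle, so it has an old vertex
    besides \<open>u\<close>; strictness depends on this.\<close>
  have pq: "0 < length bs + length as"
    using c(4,5) ns(4) by (cases as; cases bs) auto
  have "(\<Sum>v \<in> W \<union> set ns. resistance_distance G u v)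
      = (\<Sum>v \<in> W. resistance_distance G u v) + (\<Sum>v \<in> set ns. resistance_distance G u v)"
    using ns fin by (intro sum.union_disjoint) auto
  also have "\<dots> < (real (card W) ^ 2 - 1) / 6
      + (2 * real (card W) * real (length ns) + real (length ns) ^ 2) / 6"
    using le sum_resistance_cycle_segment_le[OF c(1)] sum_cycle_segment_less[OF ns(1) pq n]
    by linarith
  also have "\<dots> = (real (card W + length ns) ^ 2 - 1) / 6"
    by (simp add: power2_eq_square field_simps)
  also have "card W + length ns = card (W \<union> set ns)"
    using ns fin by (simp add: card_Un_disjoint distinct_card)
  finally show ?thesis .
qed

end

section \<open>Exhausting a 2-connected graph by ears\<close>

locale biconnected_graph = connected_graph +
  assumes connected_del_vert:
    "a \<in> verts G \<Longrightarrow> v \<in> verts G - {a} \<Longrightarrow> w \<in> verts G - {a} \<Longrightarrow> v \<rightarrow>\<^sup>*\<^bsub>del_vert a\<^esub> w"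
begin

lemma leaving_arc_exists:
  assumes "W \<subset> verts G" "W \<noteq> {}"
  shows "\<exists>a b. a \<in> W \<and> b \<in> verts G - W \<and> a \<rightarrow>\<^bsub>G\<^esub> b"
proof -
  obtain w z where "w \<in> W" "z \<in> verts G - W"
    using assms by blast
  then have "w \<rightarrow>\<^sup>*\<^bsub>G\<^esub> z"
    using assms(1) connected by auto
  then show ?thesis
    using \<open>w \<in> W\<close> \<open>z \<in> verts G - W\<close>
    by (induct rule: converse_reachable_induct) (auto dest: adj_in_verts)
qed

text \<open>An arc from \<open>a\<close> in \<open>W\<close> to a new vertex \<open>b\<close> starts
  the ear. Without \<open>a\<close>, the vertex \<open>b\<close> still reaches the rest of
  \<open>W\<close>, so the first hit ends the ear at a vertex other than \<open>a\<close>.\<close>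

lemma ear_exists:
  assumes "W \<subset> verts G" "p \<in> W" "q \<in> W" "p \<noteq> q"
  obtains x ns y where "ear G W x ns y" "set ns \<subseteq> verts G"
proof -
  obtain a b where ab: "a \<in> W" "b \<in> verts G - W" "a \<rightarrow>\<^bsub>G\<^esub> b"
    using leaving_arc_exists assms by blast
  obtain z where z: "z \<in> W - {a}"
    using assms by blast
  interpret D: wf_digraph "del_vert a"
    by (rule wf_digraph_del_vert)
  have "b \<rightarrow>\<^sup>*\<^bsub>del_vert a\<^esub> z"
    using ab z assms(1) by (intro connected_del_vert) auto
  from D.first_hit_path[OF this, of "W - {a}"] obtain ns y
    where ns: "ns \<noteq> []" "hd ns = b" "distinct ns" "set ns \<inter> (W - {a}) = {}" "y \<in> W - {a}"
      "successively (dominates (del_vert a)) (ns @ [y])"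
    using ab z by blast
  have del: "v \<rightarrow>\<^bsub>G\<^esub> w \<and> v \<noteq> a \<and> w \<noteq> a" if "v \<rightarrow>\<^bsub>del_vert a\<^esub> w" for v w
    using that by (auto simp: arcs_ends_def arcs_del_vert ends_del_vert) (auto simp: arc_to_ends_def)
  \<comment> \<open>An outgoing arc in the graph without \<open>a\<close> shows that an inner vertex
    belongs to \<open>G\<close> and differs from \<open>a\<close>.\<close>
  have arc: "\<exists>w. v \<rightarrow>\<^bsub>del_vert a\<^esub> w" if "v \<in> set ns" for v
  proof -
    obtain ps qs where "ns = ps @ v # qs"
      using \<open>v \<in> set ns\<close> by (meson split_list)
    with ns(6) have "v \<rightarrow>\<^bsub>del_vert a\<^esub> hd (qs @ [y])"
      by (cases qs) (auto simp: successively_append_iff)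
    then show ?thesis ..
  qed
  have "successively (dominates G) (ns @ [y])"
    using ns(6) by (rule successively_mono) (use del in blast)
  moreover have "a \<notin> set ns"
    using arc del by blast
  ultimately have "ear G W a ns y"
    using ab ns assms(1) by (auto simp: ear_def successively_Cons)
  moreover have "set ns \<subseteq> verts G"
    using arc del adj_in_verts(1) by blast
  ultimately show ?thesis using that by blast
qed

text \<open>Each further ear preserves both the invariant and strictness; the induction is on the
  number of vertices still outside \<open>W\<close>. The vertices \<open>p\<close> and
  \<open>q\<close> keep \<open>ear_exists\<close> applicable.\<close>

lemma joined_through_grow:
  assumes "W \<subseteq> verts G" "p \<in> W" "q \<in> W" "p \<noteq> q" "joined_through G u W"
    "(\<Sum>v \<in> W. resistance_distance G u v) < (real (card W) ^ 2 - 1) / 6"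
  shows "(\<Sum>v \<in> verts G. resistance_distance G u v) < (real (card (verts G)) ^ 2 - 1) / 6"
  using assms
proof (induct "card (verts G - W)" arbitrary: W rule: less_induct)
  case less
  show ?case
  proof (cases "W = verts G")
    case True
    with less show ?thesis by simp
  next
    case False
    with less obtain x ns y where e: "ear G W x ns y" "set ns \<subseteq> verts G"
      using ear_exists[of W p q] by blast
    have fin: "finite W"
      using finite_subset[OF less.prems(1)] by simp
    have "verts G - (W \<union> set ns) \<subset> verts G - W"
      using e by (cases ns) (auto simp: ear_def)
    then have "card (verts G - (W \<union> set ns)) < card (verts G - W)"
      by (intro psubset_card_mono) auto
    then show ?thesis
      using less e joined_through_ear[OF e(1) less.prems(5)]
        sum_resistance_ear_less[OF e(1) less.prems(5) fin]
      by (intro less.hyps[of "W \<union> set ns"]) auto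
  qed
qed

text \<open>An ear attached to an edge at \<open>u\<close> gives a cycle through \<open>u\<close>.
  If it misses a vertex, a second ear makes the inequality strict and the remaining ears keep it
  so.\<close>

lemma resistance_sum_less_or_hamiltonian:
  assumes u: "u \<in> verts G" and card: "3 \<le> card (verts G)"
  shows "(\<Sum>v \<in> verts G. resistance_distance G u v) < (real (card (verts G)) ^ 2 - 1) / 6
    \<or> (\<exists>ds. cycle_at G u ds \<and> set (u # ds) = verts G)"
proof -
  have "{u} \<noteq> verts G"
    using card by (metis card.empty card_insert_if empty_iff finite.emptyI numeral_le_one_iff
        One_nat_def semiring_norm(70))
  with u obtain b where b: "b \<in> verts G" "b \<noteq> u" "u \<rightarrow>\<^bsub>G\<^esub> b"
    using leaving_arc_exists[of "{u}"] by blast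
  define W where "W = {u, b}"
  have "joined_through G u W"
    unfolding joined_through_def
  proof (intro ballI impI)
    fix x y
    assume "x \<in> W" "y \<in> W" "x \<noteq> y"
    then show "\<exists>xs. simple_path G W x y xs \<and> u \<in> set xs"
      using b graph_symmetric[OF b(3)]
      by (intro exI[of _ "[x, y]"]) (auto simp: simple_path_def W_def)
  qed
  note J = this
  have "card W = 2"
    using b by (simp add: W_def)
  with card have "W \<noteq> verts G" by auto
  then have "W \<subset> verts G"
    using u b by (auto simp: W_def)
  from ear_exists[OF this, of u b] b obtain x ns y
    where e: "ear G W x ns y" "set ns \<subseteq> verts G"
    by (auto simp: W_def)
  obtain as bs where c: "cycle_at G u (bs @ ns @ as)" "set (as @ u # bs) \<subseteq> W"
    "x \<in> set (as @ u # bs)" "y \<in> set (as @ u # bs)"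
    using cycle_through_ear[OF e(1) J] by metis
  define ds where "ds = bs @ ns @ as"
  \<comment> \<open>The distinct ends of the ear are the only two elements of \<open>W\<close>, so
    the cycle contains all of \<open>W\<close>.\<close>
  have "W \<subseteq> set (as @ u # bs)"
    using c(3,4) e(1) by (auto simp: ear_def W_def)
  with c(2) have W: "W \<union> set ns = set (u # ds)"
    by (auto simp: ds_def)
  have cyc: "cycle_at G u ds"
    using c(1) by (simp add: ds_def)
  show ?thesis
  proof (cases "set (u # ds) = verts G")
    case True
    with cyc show ?thesis by blast
  next
    case False
    let ?W = "set (u # ds)"
    have sub: "?W \<subset> verts G"
      using False cycle_at_in_verts[OF cyc] by blast
    have J': "joined_through G u ?W"
      using joined_through_ear[OF e(1) J] W by simp
    have mem: "u \<in> ?W" "b \<in> ?W" "u \<noteq> b"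
      using W b by (auto simp: W_def)
    obtain x' ns' y' where e': "ear G ?W x' ns' y'" "set ns' \<subseteq> verts G"
      using ear_exists[OF sub mem] .
    have "length (u # ds) = card ?W"
      using cyc by (metis cycle_at_def distinct_card)
    then have "(\<Sum>v \<in> ?W. resistance_distance G u v) \<le> (real (card ?W) ^ 2 - 1) / 6"
      using sum_resistance_cycle_le[OF cyc] by metis
    then have "(\<Sum>v \<in> ?W \<union> set ns'. resistance_distance G u v) < (real (card (?W \<union> set ns')) ^ 2 - 1) / 6"
      by (rule sum_resistance_ear_less[OF e'(1) J' finite_set])
    then show ?thesis
      using joined_through_grow[of "?W \<union> set ns'" u b u] joined_through_ear[OF e'(1) J'] sub mem e'(2)
      by auto
  qed
qed

end

section \<open>The extremal graph\<close>

text \<open>A numbering of the vertices stands in for \<open>digraph_iso\<close>, whose arc map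
  would otherwise have to be carried along.\<close>

definition cycle_labelling :: "('a, 'b) pre_digraph \<Rightarrow> nat \<Rightarrow> (nat \<Rightarrow> 'a) \<Rightarrow> bool" where
  "cycle_labelling G n f \<longleftrightarrow> bij_betw f {..<n} (verts G) \<and>
     (\<forall>i < n. \<forall>j < n. f i \<rightarrow>\<^bsub>G\<^esub> f j \<longleftrightarrow> j = Suc i mod n \<or> i = Suc j mod n)"

text \<open>Neither graph has parallel arcs, so an isomorphism is determined by its vertex map; the
  labelling is the inverse of that map.\<close>

lemma (in graph) digraph_iso_cycle_graph_iff:
  "digraph_iso G (with_proj (cycle_graph n)) \<longleftrightarrow> (\<exists>f. cycle_labelling G n f)"
proof
  assume "digraph_iso G (with_proj (cycle_graph n))"
  then obtain hom where hom: "digraph_isomorphism hom" and eq: "with_proj (cycle_graph n) = app_iso hom G"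
    unfolding digraph_iso_def by blast
  define h where "h = iso_verts hom"
  \<comment> \<open>Arcs of \<open>with_proj\<close> are pairs with projections as ends; comparing
    record fields determines the components of \<open>hom\<close>.\<close>
  have tail: "iso_tail hom = fst" and head: "iso_head hom = snd"
    and verts: "h ` verts G = {..<n}" and arcs: "iso_arcs hom ` arcs G = parcs (cycle_graph n)"
    using arg_cong[OF eq, of tail] arg_cong[OF eq, of head] arg_cong[OF eq, of verts]
      arg_cong[OF eq, of arcs]
    by (auto simp: app_iso_def h_def cycle_graph_def)
  have inj: "inj_on h (verts G)"
    and ends: "\<And>a. a \<in> arcs G \<Longrightarrow> iso_arcs hom a = (h (tail G a), h (head G a))"
    using hom by (auto simp: digraph_isomorphism_def h_def tail head prod_eq_iff)
  have adj: "v \<rightarrow>\<^bsub>G\<^esub> w \<longleftrightarrow> (h v, h w) \<in> parcs (cycle_graph n)" if vw: "v \<in> verts G" "w \<in> verts G" for v w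
  proof
    assume "v \<rightarrow>\<^bsub>G\<^esub> w"
    then obtain a where "a \<in> arcs G" "tail G a = v" "head G a = w"
      by (rule reachableE)
    with ends[of a] arcs show "(h v, h w) \<in> parcs (cycle_graph n)"
      by (metis image_eqI)
  next
    assume "(h v, h w) \<in> parcs (cycle_graph n)"
    then obtain a where a: "a \<in> arcs G" "iso_arcs hom a = (h v, h w)"
      using arcs by (metis imageE)
    then have "tail G a = v" "head G a = w"
      using ends[OF a(1)] inj vw by (auto dest: inj_onD)
    with a(1) show "v \<rightarrow>\<^bsub>G\<^esub> w"
      by (auto simp: arcs_ends_def arc_to_ends_def)
  qed
  define f where "f = the_inv_into (verts G) h"
  have f: "bij_betw f {..<n} (verts G)"
    unfolding f_def using inj verts by (intro bij_betw_the_inv_into) (simp add: bij_betw_def)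
  moreover have "h (f i) = i" if "i < n" for i
    unfolding f_def using inj verts that by (intro f_the_inv_into_f) auto
  moreover have "f i \<in> verts G" if "i < n" for i
    using f that by (auto simp: bij_betw_def)
  ultimately have "cycle_labelling G n f"
    by (simp add: cycle_labelling_def adj) (simp add: cycle_graph_def)
  then show "\<exists>f. cycle_labelling G n f" by blast
next
  assume "\<exists>f. cycle_labelling G n f"
  then obtain f where f: "bij_betw f {..<n} (verts G)"
    and adj: "\<And>i j. i < n \<Longrightarrow> j < n \<Longrightarrow> f i \<rightarrow>\<^bsub>G\<^esub> f j \<longleftrightarrow> j = Suc i mod n \<or> i = Suc j mod n"
    by (auto simp: cycle_labelling_def)
  define h where "h = the_inv_into {..<n} f"
  have h: "bij_betw h (verts G) {..<n}"
    unfolding h_def by (rule bij_betw_the_inv_into[OF f])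
  have fh: "f (h v) = v" and hn: "h v < n" if "v \<in> verts G" for v
    using f h that by (auto simp: h_def bij_betw_def intro: f_the_inv_into_f)
  have hf: "h (f i) = i" and fV: "f i \<in> verts G" if "i < n" for i
    using f that by (auto simp: h_def bij_betw_def the_inv_into_f_f)
  define e where "e a = (h (tail G a), h (head G a))" for a
  let ?hom = "\<lparr>iso_verts = h, iso_arcs = e, iso_head = snd, iso_tail = fst\<rparr>"
  have "inj_on e (arcs G)"
  proof (rule inj_onI)
    fix a b
    assume ab: "a \<in> arcs G" "b \<in> arcs G" "e a = e b"
    then have "tail G a = tail G b" "head G a = head G b"
      using h by (auto simp: e_def bij_betw_def dest: inj_onD)
    with ab show "a = b"
      by (intro no_multi_arcs) (auto simp: arc_to_ends_def)
  qed
  then have "digraph_isomorphism ?hom"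
    using h wf_digraph by (auto simp: digraph_isomorphism_def e_def bij_betw_def)
  moreover have "e ` arcs G = parcs (cycle_graph n)"
  proof (intro equalityI subsetI)
    fix p
    assume "p \<in> e ` arcs G"
    then obtain a where a: "a \<in> arcs G" "p = e a" by blast
    then have "f (h (tail G a)) \<rightarrow>\<^bsub>G\<^esub> f (h (head G a))"
      by (auto simp: fh arcs_ends_def arc_to_ends_def)
    with adj a show "p \<in> parcs (cycle_graph n)"
      by (auto simp: cycle_graph_def e_def hn)
  next
    fix p
    assume p: "p \<in> parcs (cycle_graph n)"
    obtain i j where ij: "p = (i, j)" by (cases p)
    with p have "i < n" "j < n" "f i \<rightarrow>\<^bsub>G\<^esub> f j"
      using adj by (auto simp: cycle_graph_def)
    then obtain a where "a \<in> arcs G" "tail G a = f i" "head G a = f j"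
      by (auto elim: reachableE)
    then have "p = e a"
      using hf \<open>i < n\<close> \<open>j < n\<close> by (simp add: ij e_def)
    then show "p \<in> e ` arcs G"
      using \<open>a \<in> arcs G\<close> by blast
  qed
  then have "with_proj (cycle_graph n) = app_iso ?hom G"
    using h by (auto simp: with_proj_def app_iso_def bij_betw_def cycle_graph_def lessThan_atLeast0)
  ultimately show "digraph_iso G (with_proj (cycle_graph n))"
    unfolding digraph_iso_def by blast
qed

text \<open>Rotation commutes with the cyclic successor. It serves to move an arbitrary vertex to
  index 0.\<close>

lemma cycle_labelling_rotate:
  assumes "cycle_labelling G n f" "k < n"
  shows "cycle_labelling G n (\<lambda>i. f ((i + k) mod n))"
proof -
  let ?r = "\<lambda>i. (i + k) mod n"
  have n: "0 < n" using assms(2) by simp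
  have "?r i = (if i + k < n then i + k else i + k - n)" if "i < n" for i
    using that assms(2) by (simp add: le_mod_geq)
  then have inj: "inj_on ?r {..<n}"
    by (intro inj_onI) (auto split: if_splits)
  then have r: "bij_betw ?r {..<n} {..<n}"
    using n by (intro bij_betw_imageI endo_inj_surj) auto
  have step: "?r j = Suc (?r i) mod n \<longleftrightarrow> j = Suc i mod n" if "i < n" "j < n" for i j
  proof -
    have "Suc (?r i) mod n = ?r (Suc i mod n)"
      by (simp add: mod_Suc_eq mod_add_left_eq)
    then show ?thesis
      using inj_on_eq_iff[OF inj, of j "Suc i mod n"] that n by simp
  qed
  show ?thesis
    unfolding cycle_labelling_def
  proof (intro conjI allI impI)
    show "bij_betw (\<lambda>i. f (?r i)) {..<n} (verts G)"
      using bij_betw_trans[OF r, of f] assms(1) by (simp add: cycle_labelling_def comp_def)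
  next
    fix i j
    assume "i < n" "j < n"
    then show "f (?r i) \<rightarrow>\<^bsub>G\<^esub> f (?r j) \<longleftrightarrow> j = Suc i mod n \<or> i = Suc j mod n"
      using assms(1) step n by (simp add: cycle_labelling_def)
  qed
qed

text \<open>Cross-multiplication cancels \<open>a * a' * b\<close> and leaves
  \<open>a * b\<^sup>2 < a' * b\<^sup>2\<close>.\<close>

lemma parallel_resistance_strict_mono:
  fixes a a' b :: real
  assumes "0 < a" "a < a'" "0 < b"
  shows "a * b / (a + b) < a' * b / (a' + b)"
proof -
  have "a * (b * b) < a' * (b * b)"
    using assms by simp
  then show ?thesis
    using assms by (simp add: field_simps)
qed

section \<open>Chords and strictness\<close>

context connected_graph
begin

text \<open>The chord cuts off part of the cycle; its end is closer to \<open>u\<close> on the remaining cycle.\<close>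

lemma sum_resistance_chord_less:
  assumes cyc: "cycle_at G u ds" and st: "s < t" "t \<le> length ds" "t \<noteq> Suc s" "\<not> (s = 0 \<and> t = length ds)"
    and chord: "(u # ds) ! s \<rightarrow>\<^bsub>G\<^esub> (u # ds) ! t"
  shows "(\<Sum>v \<in> set (u # ds). resistance_distance G u v) < (real (length (u # ds)) ^ 2 - 1) / 6"
proof -
  \<comment> \<open>\<open>r\<close> is the position in \<open>ds\<close> of the vertex at position
    \<open>t\<close> of \<open>u # ds\<close>.\<close>
  obtain r where r: "t = Suc r" using st(1) by (cases t) auto
  have len: "r < length ds" "s < r"
    using st r by auto
  let ?b = "ds ! r"
  have dist: "distinct (u # ds)" and succ: "successively (dominates G) (u # ds @ [u])"
    using cyc by (auto simp: cycle_at_def)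
  have drop: "drop r ds = ?b # drop t ds"
    using len r by (simp add: Cons_nth_drop_Suc)
  have "successively (dominates G) ((u # take s ds) @ drop s ds @ [u])"
    using succ by (simp flip: append_assoc)
  then have 1: "successively (dominates G) (u # take s ds)"
    unfolding successively_append_iff by blast
  have "successively (dominates G) ((u # take r ds) @ drop r ds @ [u])"
    using succ by (simp flip: append_assoc)
  then have 2: "successively (dominates G) (drop r ds @ [u])"
    unfolding successively_append_iff by blast
  have "last (u # take s ds) = (u # ds) ! s"
    using len by (cases s) (auto simp: take_Suc_conv_app_nth)
  then have "successively (dominates G) ((u # take s ds) @ drop r ds @ [u])"
    unfolding successively_append_iff[of _ "u # take s ds"] using 1 2 chord by (simp add: drop r)
  moreover have "distinct (u # take s ds @ drop r ds)"
    using dist set_take_disj_set_drop_if_distinct[of ds s r] len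
    by (auto dest: in_set_takeD in_set_dropD)
  \<comment> \<open>This fails only for \<open>s = 0\<close> and \<open>t = length ds\<close>, the
    closing edge of the cycle.\<close>
  moreover have "2 \<le> length (take s ds @ drop r ds)"
    using len st r by auto
  ultimately have "cycle_at G u (take s ds @ ?b # drop t ds)"
    unfolding cycle_at_def by (simp add: drop)
  from resistance_distance_le_cycle[OF this]
  have "resistance_distance G u ?b
      \<le> real (Suc s) * real (length ds - r) / (real (Suc s) + real (length ds - r))"
    using len r by (simp add: min_def of_nat_diff algebra_simps)
  \<comment> \<open>The chord shortens one arc from \<open>t\<close> to \<open>Suc s\<close> edges
    and leaves the other as it was.\<close>
  also have "\<dots> < real t * real (length ds - r) / (real t + real (length ds - r))"
    using len r by (intro parallel_resistance_strict_mono) auto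
  also have "real t + real (length ds - r) = real (Suc (length ds))"
    using len r by (simp add: of_nat_diff)
  finally have strict: "resistance_distance G u (ds ! r)
      < real (Suc r) * real (length ds - r) / real (Suc (length ds))"
    by (simp add: r)
  have "u \<in> verts G"
    using cycle_at_in_verts[OF cyc] by simp
  then have "(\<Sum>v \<in> set (u # ds). resistance_distance G u v) = (\<Sum>v \<in> set ds. resistance_distance G u v)"
    using dist by (simp add: resistance_distance_self)
  also have "\<dots> = (\<Sum>i < length ds. resistance_distance G u (ds ! i))"
    using dist by (intro sum.reindex_bij_betw[symmetric] bij_betw_nth) auto
  also have "\<dots> < (\<Sum>i < length ds. real (Suc i) * real (length ds - i) / real (Suc (length ds)))"
    using len strict resistance_distance_nth_le[OF cyc]
    by (intro sum_strict_mono_ex1 bexI[of _ r]) auto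
  also have "\<dots> = (real (length (u # ds)) ^ 2 - 1) / 6"
    unfolding sum_cycle by simp
  finally show ?thesis .
qed

text \<open>A chord would make the sum strictly smaller, so under equality only cyclically
  consecutive vertices are adjacent.\<close>

lemma hamiltonian_cycle_labelling:
  assumes cyc: "cycle_at G u ds" and span: "set (u # ds) = verts G"
    and eq: "(\<Sum>v \<in> verts G. resistance_distance G u v) = (real (card (verts G)) ^ 2 - 1) / 6"
  shows "cycle_labelling G (card (verts G)) ((!) (u # ds))"
proof -
  let ?c = "u # ds" and ?n = "Suc (length ds)"
  have dist: "distinct ?c"
    using cyc by (auto simp: cycle_at_def)
  then have card: "card (verts G) = ?n"
    unfolding span[symmetric] by (simp add: distinct_card)
  have chordless: "t = Suc s \<or> s = 0 \<and> t = length ds"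
    if "s < t" "t < ?n" "?c ! s \<rightarrow>\<^bsub>G\<^esub> ?c ! t" for s t
    using sum_resistance_chord_less[OF cyc that(1), OF _ _ _ that(3)] that(2) eq
    unfolding span card by fastforce
  have "?c ! i \<rightarrow>\<^bsub>G\<^esub> ?c ! j \<longleftrightarrow> j = Suc i mod ?n \<or> i = Suc j mod ?n" if ij: "i < ?n" "j < ?n" for i j
  proof
    assume adj: "?c ! i \<rightarrow>\<^bsub>G\<^esub> ?c ! j"
    then have "i \<noteq> j"
      using adj_not_same by metis
    then consider "i < j" | "j < i" by linarith
    then show "j = Suc i mod ?n \<or> i = Suc j mod ?n"
    proof cases
      case 1
      with chordless[OF 1 ij(2) adj] ij show ?thesis by auto
    next
      case 2
      with chordless[OF 2 ij(1) graph_symmetric[OF adj]] ij show ?thesis by auto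
    qed
  next
    assume "j = Suc i mod ?n \<or> i = Suc j mod ?n"
    then show "?c ! i \<rightarrow>\<^bsub>G\<^esub> ?c ! j"
      using cycle_at_nth_adj[OF cyc ij(1)] graph_symmetric[OF cycle_at_nth_adj[OF cyc ij(2)]] by metis
  qed
  moreover have "bij_betw ((!) ?c) {..<?n} (verts G)"
    using dist span by (intro bij_betw_nth) auto
  ultimately show ?thesis
    by (simp add: cycle_labelling_def card)
qed

text \<open>An explicit potential, linear on both arcs between the two vertices: the current divides
  into \<open>(n - j) / n\<close> on the arc with \<open>j\<close> edges and \<open>j / n\<close> on
  the other.\<close>

lemma resistance_distance_cycle_labelling:
  assumes lab: "cycle_labelling G n f" and n: "3 \<le> n" and j: "j < n"
  shows "resistance_distance G (f 0) (f j) = real j * real (n - j) / real n"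
proof -
  have f: "bij_betw f {..<n} (verts G)"
    and adj: "\<And>a b. a < n \<Longrightarrow> b < n \<Longrightarrow> f a \<rightarrow>\<^bsub>G\<^esub> f b \<longleftrightarrow> b = Suc a mod n \<or> a = Suc b mod n"
    using lab by (auto simp: cycle_labelling_def)
  have fV: "f t \<in> verts G" if "t < n" for t
    using f that by (auto simp: bij_betw_def)
  have f_inj: "f a = f b \<longleftrightarrow> a = b" if "a < n" "b < n" for a b
    using f that by (auto simp: bij_betw_def inj_on_eq_iff)
  \<comment> \<open>\<open>g\<close> vanishes at \<open>j\<close> and satisfies
    \<open>g n = g 0\<close>, so index \<open>n\<close> may stand for index 0.\<close>
  define g where "g t = (if t \<le> j then (real j - real t) * (real n - real j) / real n
      else (real t - real j) * real j / real n)" for t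
  define \<phi> where "\<phi> v = g (the_inv_into {..<n} f v)" for v
  have \<phi>f: "\<phi> (f t) = g t" if "t < n" for t
    using f that by (simp add: \<phi>_def bij_betw_def the_inv_into_f_f)
  define prev where "prev t = (if t = 0 then n - 1 else t - 1)" for t
  have g_next: "g (Suc t mod n) = g (Suc t)" if "t < n" for t
    using that j by (cases "Suc t = n") (auto simp: g_def field_simps)
  have lap: "laplacian G \<phi> (f t) = of_bool (t = 0) - of_bool (t = j)" if t: "t < n" for t
  proof -
    \<comment> \<open>For \<open>n\<close> at least 3 the two neighbours are distinct, so the
      Laplacian has two separate terms.\<close>
    have pn: "prev t < n" "Suc t mod n < n" "prev t \<noteq> Suc t mod n"
      using t n by (auto simp: prev_def mod_Suc)
    have prev: "t = Suc b mod n \<longleftrightarrow> b = prev t" if "b < n" for b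
      using that t by (auto simp: prev_def mod_Suc)
    have "{w \<in> verts G. f t \<rightarrow>\<^bsub>G\<^esub> w} = {f (Suc t mod n), f (prev t)}"
    proof (intro equalityI subsetI)
      fix w
      assume w: "w \<in> {w \<in> verts G. f t \<rightarrow>\<^bsub>G\<^esub> w}"
      then obtain b where "b < n" "w = f b"
        using f by (auto simp: bij_betw_def)
      with w adj[OF t] prev show "w \<in> {f (Suc t mod n), f (prev t)}"
        by auto
    next
      fix w
      assume "w \<in> {f (Suc t mod n), f (prev t)}"
      then show "w \<in> {w \<in> verts G. f t \<rightarrow>\<^bsub>G\<^esub> w}"
        using adj[OF t] prev pn fV by auto
    qed
    then have "laplacian G \<phi> (f t) = (g t - g (Suc t mod n)) + (g t - g (prev t))"
      using pn f_inj t by (simp add: laplacian_def \<phi>f)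
    also have "\<dots> = (g t - g (Suc t)) + (g t - g (prev t))"
      by (simp add: g_next[OF t])
    also have "\<dots> = of_bool (t = 0) - of_bool (t = j)"
    proof (cases t)
      \<comment> \<open>At the source the currents \<open>j / n\<close> and
        \<open>(n - j) / n\<close> add up to 1; for \<open>j = 0\<close> both differences
        vanish.\<close>
      case 0
      have "g 0 = g n"
        using j by (simp add: g_def field_simps)
      moreover have "g n - g (n - 1) = real j / real n"
        using j n by (cases "j = n - 1") (auto simp: g_def field_simps of_nat_diff)
      ultimately have last: "g 0 - g (n - 1) = real j / real n"
        by simp
      have first: "g 0 - g (Suc 0) = (if j = 0 then 0 else (real n - real j) / real n)"
        using n by (auto simp: g_def field_simps)
      show ?thesis
      proof (cases "j = 0")
        case True
        with 0 first last show ?thesis by (simp add: prev_def)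
      next
        case False
        with n first have "g 0 - g (Suc 0) + real j / real n = 1"
          by (simp add: field_simps)
        with 0 False last show ?thesis by (simp add: prev_def)
      qed
    next
      case (Suc m)
      consider "t < j" | "t = j" | "j < t" by linarith
      then show ?thesis
        using Suc n by cases (auto simp: prev_def g_def field_simps)
    qed
    finally show ?thesis .
  qed
  have "laplacian G \<phi> v = of_bool (v = f 0) - of_bool (v = f j)" if v: "v \<in> verts G" for v
  proof -
    obtain t where "t < n" "v = f t"
      using f v by (auto simp: bij_betw_def)
    then show ?thesis
      using lap[of t] f_inj[of t 0] f_inj[of t j] j n by simp
  qed
  then have "unit_current_potential G (f 0) (f j) \<phi>"
    by (simp add: unit_current_potential_laplacian)
  from resistance_distance_eq[OF this] show ?thesis
    using fV j n \<phi>f by (simp add: g_def of_nat_diff)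
qed

lemma sum_resistance_cycle_labelling:
  assumes lab: "cycle_labelling G n f" and n: "3 \<le> n" and u: "u \<in> verts G"
  shows "(\<Sum>v \<in> verts G. resistance_distance G u v) = (real n ^ 2 - 1) / 6"
proof -
  have "u \<in> f ` {..<n}"
    using lab u by (simp add: cycle_labelling_def bij_betw_def)
  then obtain k where k: "k < n" "u = f k"
    by auto
  define f' where "f' i = f ((i + k) mod n)" for i
  have lab': "cycle_labelling G n f'"
    unfolding f'_def by (rule cycle_labelling_rotate[OF lab k(1)])
  have u': "u = f' 0"
    using k by (simp add: f'_def)
  have "(\<Sum>v \<in> verts G. resistance_distance G u v) = (\<Sum>j<n. resistance_distance G u (f' j))"
    using lab' by (intro sum.reindex_bij_betw[symmetric]) (simp add: cycle_labelling_def)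
  \<comment> \<open>The summand \<open>0\<close> brings the terms into the form of
    \<open>sum_linear_product\<close> with \<open>P = 0\<close> and \<open>Q = n\<close>.\<close>
  also have "\<dots> = (\<Sum>j<n. (0 + real j) * (real n - real j) / real n)"
    by (intro sum.cong refl)
      (simp add: u' resistance_distance_cycle_labelling[OF lab' n] of_nat_diff)
  also have "\<dots> = (\<Sum>j<n. (0 + real j) * (real n - real j)) / real n"
    by (rule sum_divide_distrib[symmetric])
  also have "\<dots> = (real n ^ 2 - 1) / 6"
    unfolding sum_linear_product using n by (simp add: field_simps power2_eq_square)
  finally show ?thesis .
qed

end

section \<open>The bound and the case of equality\<close>

lemma two_connected_imp_biconnected_graph:
  assumes "graph G" "two_connected G"
  shows "biconnected_graph G"
proof -
  interpret graph G by fact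
  have "strongly_connected G"
    using assms(2) symmetric_connected_imp_strongly_connected[OF sym_arcs]
    by (simp add: two_connected_def)
  then have conn: "v \<rightarrow>\<^sup>*\<^bsub>G\<^esub> w" if "v \<in> verts G" "w \<in> verts G" for v w
    using that by (auto simp: strongly_connected_def)
  show ?thesis
  proof
    show "v \<rightarrow>\<^sup>*\<^bsub>G\<^esub> w" if "v \<in> verts G" "w \<in> verts G" for v w
      using that by (rule conn)
  next
    fix a v w
    assume "a \<in> verts G" "v \<in> verts G - {a}" "w \<in> verts G - {a}"
    then show "v \<rightarrow>\<^sup>*\<^bsub>del_vert a\<^esub> w"
      using assms(2) conn by (auto simp: two_connected_def cut_vertex_def)
  qed
qed

theorem theorem2p6:
  fixes G :: "('a, 'b) pre_digraph" and n :: nat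
  assumes "graph G"
    and "two_connected G"
    and "card (verts G) = n"
    and "n \<ge> 3"
  shows "\<forall>u \<in> verts G.
    resistive_eccentricity G u \<le> (real n ^ 2 - 1) / 6 \<and>
    (resistive_eccentricity G u = (real n ^ 2 - 1) / 6 \<longleftrightarrow>
      digraph_iso G (with_proj (cycle_graph n)))"
proof
  fix u
  assume u: "u \<in> verts G"
  interpret biconnected_graph G
    using assms(1,2) by (rule two_connected_imp_biconnected_graph)
  have le: "resistive_eccentricity G u \<le> (real n ^ 2 - 1) / 6"
    and lab: "resistive_eccentricity G u = (real n ^ 2 - 1) / 6 \<Longrightarrow> \<exists>f. cycle_labelling G n f"
  proof -
    \<comment> \<open>The strict alternative settles both claims, as equality is then
      impossible.\<close>
    consider "resistive_eccentricity G u < (real n ^ 2 - 1) / 6"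
      | ds where "cycle_at G u ds" "set (u # ds) = verts G"
      using resistance_sum_less_or_hamiltonian[OF u] assms(3,4)
      by (auto simp: resistive_eccentricity_def)
    then have "resistive_eccentricity G u \<le> (real n ^ 2 - 1) / 6 \<and>
      (resistive_eccentricity G u = (real n ^ 2 - 1) / 6 \<longrightarrow> (\<exists>f. cycle_labelling G n f))"
    proof cases
      case 2
      have "card (verts G) = length (u # ds)"
        using 2 by (metis cycle_at_def distinct_card)
      with sum_resistance_cycle_le[OF 2(1)] have "resistive_eccentricity G u \<le> (real n ^ 2 - 1) / 6"
        unfolding resistive_eccentricity_def 2(2) assms(3) by simp
      moreover have "\<exists>f. cycle_labelling G n f" if "resistive_eccentricity G u = (real n ^ 2 - 1) / 6"
        using hamiltonian_cycle_labelling[OF 2] that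
        unfolding resistive_eccentricity_def assms(3) by blast
      ultimately show ?thesis by blast
    qed simp
    then show "resistive_eccentricity G u \<le> (real n ^ 2 - 1) / 6"
      and "resistive_eccentricity G u = (real n ^ 2 - 1) / 6 \<Longrightarrow> \<exists>f. cycle_labelling G n f"
      by blast+
  qed
  moreover have "resistive_eccentricity G u = (real n ^ 2 - 1) / 6" if "\<exists>f. cycle_labelling G n f"
    using that sum_resistance_cycle_labelling[OF _ assms(4) u]
    unfolding resistive_eccentricity_def by blast
  ultimately show "resistive_eccentricity G u \<le> (real n ^ 2 - 1) / 6 \<and>
    (resistive_eccentricity G u = (real n ^ 2 - 1) / 6 \<longleftrightarrow>
      digraph_iso G (with_proj (cycle_graph n)))"
    unfolding digraph_iso_cycle_graph_iff by blast
qed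

end
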